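(* Let $n\in\mathbb{N}$ and let $\mathbf{k}$ be a commutative ring. Let $i,j\in[n]$ be such that $i\leq j$. Then, in $\mathbf{k}[S_n]$, $$[t_i,t_j]^{\,j-i+1}=0.$$
   Context: Here $\mathbb{N}=\{0,1,2,\ldots\}$, and $[m]:=\{1,2,\ldots,m\}$. $S_n$ is the symmetric group on $[n]$, with product $(\pi\sigma)(i)=\pi(\sigma(i))$, viewed as a subset of the group algebra $\mathbf{k}[S_n]$. For distinct $i_1,\ldots,i_k\in[n]$, $\operatorname{cyc}_{i_1,\ldots,i_k}\in S_n$ is the cycle sending $i_1\mapsto i_2\mapsto\cdots\mapsto i_k\mapsto i_1$ and fixing all other elements (so $\operatorname{cyc}_i=\operatorname{id}=1$). For each $\ell\in[n]$, the somewhere-to-below shuffle is $t_\ell:=\operatorname{cyc}_{\ell}+\operatorname{cyc}_{\ell,\ell+1}+\operatorname{cyc}_{\ell,\ell+1,\ell+2}+\cdots+\operatorname{cyc}_{\ell,\ell+1,\ldots,n}\in\mathbf{k}[S_n]$. For elements $a,b$ of a ring, $[a,b]:=ab-ba$ is the commutator. *)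

theory Defs
  imports "HOL-Algebra.Sym_Groups" "HOL-Algebra.Ring"
begin

section \<open>The group algebra of the symmetric group\<close>

text \<open>
  Elements of the group algebra over \<open>R\<close> are their coefficient functions on
  \<^term>\<open>carrier (sym_group n)\<close>, made extensional so that equality in the algebra is
  equality in HOL. As the group is finite, no finite support condition is needed. The
  product is the convolution: the coefficient of \<open>fg\<close> at \<open>x\<close> is the sum of
  \<open>f(y) g(z)\<close> over all \<open>y z = x\<close>. The product of the group is
  \<^term>\<open>p \<circ> q\<close>, that is, \<open>(pq)(i) = p(q(i))\<close>.
\<close>

definition sym_group_algebra ::
    "('a, 'b) ring_scheme \<Rightarrow> nat \<Rightarrow> ((nat \<Rightarrow> nat) \<Rightarrow> 'a) ring"
  where "sym_group_algebra R n =
    \<lparr> carrier = carrier (sym_group n) \<rightarrow>\<^sub>E carrier R,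
      mult = (\<lambda>f g. \<lambda>x\<in>carrier (sym_group n).
        \<Oplus>\<^bsub>R\<^esub>y\<in>carrier (sym_group n).
          f y \<otimes>\<^bsub>R\<^esub> g (inv\<^bsub>sym_group n\<^esub> y \<otimes>\<^bsub>sym_group n\<^esub> x)),
      one = (\<lambda>x\<in>carrier (sym_group n).
        if x = \<one>\<^bsub>sym_group n\<^esub> then \<one>\<^bsub>R\<^esub> else \<zero>\<^bsub>R\<^esub>),
      zero = (\<lambda>x\<in>carrier (sym_group n). \<zero>\<^bsub>R\<^esub>),
      add = (\<lambda>f g. \<lambda>x\<in>carrier (sym_group n). f x \<oplus>\<^bsub>R\<^esub> g x) \<rparr>"

definition of_perm ::
    "('a, 'b) ring_scheme \<Rightarrow> nat \<Rightarrow> (nat \<Rightarrow> nat) \<Rightarrow> (nat \<Rightarrow> nat) \<Rightarrow> 'a"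
  where "of_perm R n p =
    (\<lambda>x\<in>carrier (sym_group n). if x = p then \<one>\<^bsub>R\<^esub> else \<zero>\<^bsub>R\<^esub>)"

text \<open>
  The somewhere-to-below shuffle \<open>t\<^sub>\<ell>\<close>. The list \<^term>\<open>[l..<Suc m]\<close> is
  \<open>l, l + 1, \<dots>, m\<close>, so \<^term>\<open>cycle_of_list [l..<Suc m]\<close> is the cycle
  \<open>l \<mapsto> l + 1 \<mapsto> \<dots> \<mapsto> m \<mapsto> l\<close>, which is the identity for \<open>m = l\<close>.
\<close>

definition somewhere_to_below ::
    "('a, 'b) ring_scheme \<Rightarrow> nat \<Rightarrow> nat \<Rightarrow> (nat \<Rightarrow> nat) \<Rightarrow> 'a"
  where "somewhere_to_below R n l =
    (\<Oplus>\<^bsub>sym_group_algebra R n\<^esub>m\<in>{l..n}. of_perm R n (cycle_of_list [l..<Suc m]))"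

definition ring_commutator :: "('a, 'b) ring_scheme \<Rightarrow> 'a \<Rightarrow> 'a \<Rightarrow> 'a"
  where "ring_commutator A a b = a \<otimes>\<^bsub>A\<^esub> b \<ominus>\<^bsub>A\<^esub> b \<otimes>\<^bsub>A\<^esub> a"


section \<open>The group algebra is a ring\<close>

lemma finite_sym_group: "finite (carrier (sym_group n))"
  by (simp add: sym_group_def finite_permutations)

lemma (in abelian_monoid) finsum_swap:
  assumes "finite A" "finite B" "\<And>x y. x \<in> A \<Longrightarrow> y \<in> B \<Longrightarrow> f x y \<in> carrier G"
  shows "(\<Oplus>x\<in>A. \<Oplus>y\<in>B. f x y) = (\<Oplus>y\<in>B. \<Oplus>x\<in>A. f x y)"
  using assms(1,3)
proof (induction A rule: finite_induct)
  case empty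
  then show ?case by (simp add: finsum_zero)
next
  case (insert a A)
  have "(\<Oplus>x\<in>insert a A. \<Oplus>y\<in>B. f x y) = (\<Oplus>y\<in>B. f a y) \<oplus> (\<Oplus>x\<in>A. \<Oplus>y\<in>B. f x y)"
    using insert by (intro finsum_insert) (auto intro!: finsum_closed)
  also have "\<dots> = (\<Oplus>y\<in>B. f a y) \<oplus> (\<Oplus>y\<in>B. \<Oplus>x\<in>A. f x y)"
    using insert by simp
  also have "\<dots> = (\<Oplus>y\<in>B. f a y \<oplus> (\<Oplus>x\<in>A. f x y))"
    using insert by (intro finsum_addf[symmetric]) (auto intro!: finsum_closed)
  also have "\<dots> = (\<Oplus>y\<in>B. \<Oplus>x\<in>insert a A. f x y)"
    using insert
    by (intro finsum_cong') (auto intro!: finsum_closed finsum_insert[symmetric])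
  finally show ?case .
qed

lemma (in cring) ring_sym_group_algebra: "ring (sym_group_algebra R n)"
proof -
  define G where "G = sym_group n"
  define A where "A = sym_group_algebra R n"
  interpret G: group G
    unfolding G_def by (rule sym_group_is_group)
  have fin: "finite (carrier G)"
    unfolding G_def by (rule finite_sym_group)
  have cA: "carrier A = carrier G \<rightarrow>\<^sub>E carrier R"
    and mA: "f \<otimes>\<^bsub>A\<^esub> g = (\<lambda>x\<in>carrier G. \<Oplus>y\<in>carrier G. f y \<otimes> g (inv\<^bsub>G\<^esub> y \<otimes>\<^bsub>G\<^esub> x))"
    and oA: "\<one>\<^bsub>A\<^esub> = (\<lambda>x\<in>carrier G. if x = \<one>\<^bsub>G\<^esub> then \<one> else \<zero>)"
    and zA: "\<zero>\<^bsub>A\<^esub> = (\<lambda>x\<in>carrier G. \<zero>)"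
    and aA: "f \<oplus>\<^bsub>A\<^esub> g = (\<lambda>x\<in>carrier G. f x \<oplus> g x)" for f g
    unfolding A_def G_def sym_group_algebra_def by simp_all
  have [simp]: "f x \<in> carrier R" if "f \<in> carrier A" "x \<in> carrier G" for f x
    using that unfolding cA by auto
  have eqI: "f = g" if "f \<in> carrier A" "g \<in> carrier A" "\<And>x. x \<in> carrier G \<Longrightarrow> f x = g x" for f g
    using that unfolding cA by (auto intro: PiE_ext)
  have mC: "f \<otimes>\<^bsub>A\<^esub> g \<in> carrier A" if "f \<in> carrier A" "g \<in> carrier A" for f g
    using that by (subst cA) (auto simp: mA intro!: finsum_closed)
  have aC: "f \<oplus>\<^bsub>A\<^esub> g \<in> carrier A" if "f \<in> carrier A" "g \<in> carrier A" for f g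
    using that by (subst cA) (auto simp: aA)
  have zC: "\<zero>\<^bsub>A\<^esub> \<in> carrier A" and oC: "\<one>\<^bsub>A\<^esub> \<in> carrier A"
    unfolding cA zA oA by auto
  have [simp]: "inv\<^bsub>G\<^esub> y \<otimes>\<^bsub>G\<^esub> x = \<one>\<^bsub>G\<^esub> \<longleftrightarrow> x = y" if "x \<in> carrier G" "y \<in> carrier G" for x y
    using that by (metis G.inv_closed G.inv_equality G.inv_inv G.l_inv G.inv_comm)
  have "ring A"
  proof (rule ringI)
    show "abelian_group A"
    proof (rule abelian_groupI)
      fix f assume f: "f \<in> carrier A"
      show "\<exists>g\<in>carrier A. g \<oplus>\<^bsub>A\<^esub> f = \<zero>\<^bsub>A\<^esub>"
        by (rule bexI[of _ "\<lambda>x\<in>carrier G. \<ominus> f x"])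
           (use f in \<open>auto simp: cA aA zA l_neg PiE_iff intro!: restrict_ext\<close>)
      show "\<zero>\<^bsub>A\<^esub> \<oplus>\<^bsub>A\<^esub> f = f"
        by (rule eqI) (use f zC in \<open>simp_all add: aC\<close>, simp add: aA zA)
    next
      fix f g h assume "f \<in> carrier A" "g \<in> carrier A" "h \<in> carrier A"
      then show "f \<oplus>\<^bsub>A\<^esub> g \<oplus>\<^bsub>A\<^esub> h = f \<oplus>\<^bsub>A\<^esub> (g \<oplus>\<^bsub>A\<^esub> h)"
        by (auto simp: aA a_assoc intro!: restrict_ext)
    next
      fix f g assume "f \<in> carrier A" "g \<in> carrier A"
      then show "f \<oplus>\<^bsub>A\<^esub> g = g \<oplus>\<^bsub>A\<^esub> f"
        by (auto simp: aA a_comm intro!: restrict_ext)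
    qed (use aC zC in auto)
    show "monoid A"
    proof (rule monoidI)
      fix f g h assume f: "f \<in> carrier A" and g: "g \<in> carrier A" and h: "h \<in> carrier A"
      show "f \<otimes>\<^bsub>A\<^esub> g \<otimes>\<^bsub>A\<^esub> h = f \<otimes>\<^bsub>A\<^esub> (g \<otimes>\<^bsub>A\<^esub> h)"
      proof (rule eqI)
        fix x assume x: "x \<in> carrier G"
        have "(f \<otimes>\<^bsub>A\<^esub> g \<otimes>\<^bsub>A\<^esub> h) x =
            (\<Oplus>y\<in>carrier G. (\<Oplus>z\<in>carrier G. f z \<otimes> g (inv\<^bsub>G\<^esub> z \<otimes>\<^bsub>G\<^esub> y)) \<otimes> h (inv\<^bsub>G\<^esub> y \<otimes>\<^bsub>G\<^esub> x))"
          using x f g h by (auto simp: mA intro!: finsum_cong' finsum_closed)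
        also have "\<dots> = (\<Oplus>y\<in>carrier G. \<Oplus>z\<in>carrier G.
            f z \<otimes> g (inv\<^bsub>G\<^esub> z \<otimes>\<^bsub>G\<^esub> y) \<otimes> h (inv\<^bsub>G\<^esub> y \<otimes>\<^bsub>G\<^esub> x))"
          using x f g h fin by (intro finsum_cong') (auto intro!: finsum_closed finsum_ldistr)
        also have "\<dots> = (\<Oplus>z\<in>carrier G. \<Oplus>y\<in>carrier G.
            f z \<otimes> g (inv\<^bsub>G\<^esub> z \<otimes>\<^bsub>G\<^esub> y) \<otimes> h (inv\<^bsub>G\<^esub> y \<otimes>\<^bsub>G\<^esub> x))"
          using x f g h fin by (intro finsum_swap) auto
        also have "\<dots> = (\<Oplus>z\<in>carrier G. f z \<otimes> (g \<otimes>\<^bsub>A\<^esub> h) (inv\<^bsub>G\<^esub> z \<otimes>\<^bsub>G\<^esub> x))"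
        proof (intro finsum_cong' refl)
          fix z assume z: "z \<in> carrier G"
          have bij: "inj_on (\<lambda>w. z \<otimes>\<^bsub>G\<^esub> w) (carrier G)"
              "(\<lambda>w. z \<otimes>\<^bsub>G\<^esub> w) ` carrier G = carrier G"
            using z G.inj_on_cmult G.surj_const_mult by auto
          have "(\<Oplus>y\<in>carrier G. f z \<otimes> g (inv\<^bsub>G\<^esub> z \<otimes>\<^bsub>G\<^esub> y) \<otimes> h (inv\<^bsub>G\<^esub> y \<otimes>\<^bsub>G\<^esub> x)) =
            (\<Oplus>w\<in>carrier G. f z \<otimes> g (inv\<^bsub>G\<^esub> z \<otimes>\<^bsub>G\<^esub> (z \<otimes>\<^bsub>G\<^esub> w)) \<otimes> h (inv\<^bsub>G\<^esub> (z \<otimes>\<^bsub>G\<^esub> w) \<otimes>\<^bsub>G\<^esub> x))"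
            using finsum_reindex[of "\<lambda>y. f z \<otimes> g (inv\<^bsub>G\<^esub> z \<otimes>\<^bsub>G\<^esub> y) \<otimes> h (inv\<^bsub>G\<^esub> y \<otimes>\<^bsub>G\<^esub> x)",
                OF _ bij(1)] x z f g h unfolding bij(2) by (auto simp: Pi_def)
          also have "\<dots> = (\<Oplus>w\<in>carrier G. f z \<otimes> (g w \<otimes> h (inv\<^bsub>G\<^esub> w \<otimes>\<^bsub>G\<^esub> (inv\<^bsub>G\<^esub> z \<otimes>\<^bsub>G\<^esub> x))))"
            using x z f g h
            by (intro finsum_cong') (auto simp: G.inv_mult_group G.m_assoc m_assoc
                  simp flip: G.m_assoc)
          also have "\<dots> = f z \<otimes> (g \<otimes>\<^bsub>A\<^esub> h) (inv\<^bsub>G\<^esub> z \<otimes>\<^bsub>G\<^esub> x)"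
            using x z f g h fin by (auto simp: mA intro!: finsum_rdistr[symmetric])
          finally show "(\<Oplus>y\<in>carrier G. f z \<otimes> g (inv\<^bsub>G\<^esub> z \<otimes>\<^bsub>G\<^esub> y) \<otimes> h (inv\<^bsub>G\<^esub> y \<otimes>\<^bsub>G\<^esub> x)) =
            f z \<otimes> (g \<otimes>\<^bsub>A\<^esub> h) (inv\<^bsub>G\<^esub> z \<otimes>\<^bsub>G\<^esub> x)" .
        qed (use x f g h mC in auto)
        also have "\<dots> = (f \<otimes>\<^bsub>A\<^esub> (g \<otimes>\<^bsub>A\<^esub> h)) x"
          using x by (simp add: mA[of f])
        finally show "(f \<otimes>\<^bsub>A\<^esub> g \<otimes>\<^bsub>A\<^esub> h) x = (f \<otimes>\<^bsub>A\<^esub> (g \<otimes>\<^bsub>A\<^esub> h)) x" .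
      qed (use f g h mC in auto)
    next
      fix f assume f: "f \<in> carrier A"
      show "\<one>\<^bsub>A\<^esub> \<otimes>\<^bsub>A\<^esub> f = f"
      proof (rule eqI)
        fix x assume x: "x \<in> carrier G"
        have "(\<one>\<^bsub>A\<^esub> \<otimes>\<^bsub>A\<^esub> f) x =
            (\<Oplus>y\<in>carrier G. if \<one>\<^bsub>G\<^esub> = y then f (inv\<^bsub>G\<^esub> y \<otimes>\<^bsub>G\<^esub> x) else \<zero>)"
          using x f by (auto simp: mA oA intro!: finsum_cong')
        also have "\<dots> = f (inv\<^bsub>G\<^esub> \<one>\<^bsub>G\<^esub> \<otimes>\<^bsub>G\<^esub> x)"
          using x f fin by (intro finsum_singleton) auto
        finally show "(\<one>\<^bsub>A\<^esub> \<otimes>\<^bsub>A\<^esub> f) x = f x"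
          using x by simp
      qed (use f mC oC in auto)
      show "f \<otimes>\<^bsub>A\<^esub> \<one>\<^bsub>A\<^esub> = f"
      proof (rule eqI)
        fix x assume x: "x \<in> carrier G"
        have "(f \<otimes>\<^bsub>A\<^esub> \<one>\<^bsub>A\<^esub>) x = (\<Oplus>y\<in>carrier G. if x = y then f y else \<zero>)"
          using x f by (auto simp: mA oA intro!: finsum_cong')
        also have "\<dots> = f x"
          using x f fin by (intro finsum_singleton) auto
        finally show "(f \<otimes>\<^bsub>A\<^esub> \<one>\<^bsub>A\<^esub>) x = f x" .
      qed (use f mC oC in auto)
    qed (use mC oC in auto)
  next
    fix f g h assume f: "f \<in> carrier A" and g: "g \<in> carrier A" and h: "h \<in> carrier A"
    show "(f \<oplus>\<^bsub>A\<^esub> g) \<otimes>\<^bsub>A\<^esub> h = f \<otimes>\<^bsub>A\<^esub> h \<oplus>\<^bsub>A\<^esub> g \<otimes>\<^bsub>A\<^esub> h"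
    proof (rule eqI)
      fix x assume x: "x \<in> carrier G"
      have "((f \<oplus>\<^bsub>A\<^esub> g) \<otimes>\<^bsub>A\<^esub> h) x = (\<Oplus>y\<in>carrier G. (f \<oplus>\<^bsub>A\<^esub> g) y \<otimes> h (inv\<^bsub>G\<^esub> y \<otimes>\<^bsub>G\<^esub> x))"
        using x by (simp add: mA[of "f \<oplus>\<^bsub>A\<^esub> g" h])
      also have "\<dots> = (\<Oplus>y\<in>carrier G.
          f y \<otimes> h (inv\<^bsub>G\<^esub> y \<otimes>\<^bsub>G\<^esub> x) \<oplus> g y \<otimes> h (inv\<^bsub>G\<^esub> y \<otimes>\<^bsub>G\<^esub> x))"
        using x f g h by (intro finsum_cong') (auto simp: aA l_distr)
      also have "\<dots> = (f \<otimes>\<^bsub>A\<^esub> h \<oplus>\<^bsub>A\<^esub> g \<otimes>\<^bsub>A\<^esub> h) x"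
        using x f g h by (auto simp: mA aA intro!: finsum_addf)
      finally show "((f \<oplus>\<^bsub>A\<^esub> g) \<otimes>\<^bsub>A\<^esub> h) x = (f \<otimes>\<^bsub>A\<^esub> h \<oplus>\<^bsub>A\<^esub> g \<otimes>\<^bsub>A\<^esub> h) x" .
    qed (use f g h mC aC in auto)
    show "h \<otimes>\<^bsub>A\<^esub> (f \<oplus>\<^bsub>A\<^esub> g) = h \<otimes>\<^bsub>A\<^esub> f \<oplus>\<^bsub>A\<^esub> h \<otimes>\<^bsub>A\<^esub> g"
    proof (rule eqI)
      fix x assume x: "x \<in> carrier G"
      have "(h \<otimes>\<^bsub>A\<^esub> (f \<oplus>\<^bsub>A\<^esub> g)) x = (\<Oplus>y\<in>carrier G. h y \<otimes> (f \<oplus>\<^bsub>A\<^esub> g) (inv\<^bsub>G\<^esub> y \<otimes>\<^bsub>G\<^esub> x))"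
        using x by (simp add: mA[of h "f \<oplus>\<^bsub>A\<^esub> g"])
      also have "\<dots> = (\<Oplus>y\<in>carrier G.
          h y \<otimes> f (inv\<^bsub>G\<^esub> y \<otimes>\<^bsub>G\<^esub> x) \<oplus> h y \<otimes> g (inv\<^bsub>G\<^esub> y \<otimes>\<^bsub>G\<^esub> x))"
        using x f g h by (intro finsum_cong') (auto simp: aA r_distr)
      also have "\<dots> = (h \<otimes>\<^bsub>A\<^esub> f \<oplus>\<^bsub>A\<^esub> h \<otimes>\<^bsub>A\<^esub> g) x"
        using x f g h by (auto simp: mA aA intro!: finsum_addf)
      finally show "(h \<otimes>\<^bsub>A\<^esub> (f \<oplus>\<^bsub>A\<^esub> g)) x = (h \<otimes>\<^bsub>A\<^esub> f \<oplus>\<^bsub>A\<^esub> h \<otimes>\<^bsub>A\<^esub> g) x" .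
    qed (use f g h mC aC in auto)
  qed
  then show ?thesis
    by (simp add: A_def)
qed

lemma (in cring) of_perm_closed: "of_perm R n p \<in> carrier (sym_group_algebra R n)"
  by (auto simp: of_perm_def sym_group_algebra_def)

lemma (in cring) of_perm_mult:
  assumes "p \<in> carrier (sym_group n)" and "q \<in> carrier (sym_group n)"
  shows "of_perm R n p \<otimes>\<^bsub>sym_group_algebra R n\<^esub> of_perm R n q = of_perm R n (p \<circ> q)"
proof -
  define G where "G = sym_group n"
  interpret G: group G
    unfolding G_def by (rule sym_group_is_group)
  have fin: "finite (carrier G)"
    unfolding G_def by (rule finite_sym_group)
  have p: "p \<in> carrier G" and q: "q \<in> carrier G"
    using assms by (auto simp: G_def)
  have o: "of_perm R n p = (\<lambda>x\<in>carrier G. if x = p then \<one> else \<zero>)" for p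
    by (simp add: of_perm_def G_def)
  have "(\<Oplus>y\<in>carrier G. of_perm R n p y \<otimes> of_perm R n q (inv\<^bsub>G\<^esub> y \<otimes>\<^bsub>G\<^esub> x)) =
      (if x = p \<otimes>\<^bsub>G\<^esub> q then \<one> else \<zero>)" if x: "x \<in> carrier G" for x
  proof -
    have "(\<Oplus>y\<in>carrier G. of_perm R n p y \<otimes> of_perm R n q (inv\<^bsub>G\<^esub> y \<otimes>\<^bsub>G\<^esub> x)) =
        (\<Oplus>y\<in>carrier G. if p = y then of_perm R n q (inv\<^bsub>G\<^esub> y \<otimes>\<^bsub>G\<^esub> x) else \<zero>)"
      using x by (intro finsum_cong') (auto simp: o)
    also have "\<dots> = of_perm R n q (inv\<^bsub>G\<^esub> p \<otimes>\<^bsub>G\<^esub> x)"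
      using x p fin by (intro finsum_singleton) (auto simp: o)
    also have "\<dots> = (if x = p \<otimes>\<^bsub>G\<^esub> q then \<one> else \<zero>)"
      using x p q by (auto simp: o G.inv_solve_left' G.m_assoc[symmetric])
    finally show ?thesis .
  qed
  then show ?thesis
    by (auto simp: sym_group_algebra_def of_perm_def[of R n "p \<circ> q"] sym_group_mult
        simp flip: G_def intro!: restrict_ext) (auto simp: G_def sym_group_mult)
qed

lemma (in cring) somewhere_to_below_closed:
  "somewhere_to_below R n l \<in> carrier (sym_group_algebra R n)"
proof -
  interpret A: ring "sym_group_algebra R n"
    by (rule ring_sym_group_algebra)
  show ?thesis
    unfolding somewhere_to_below_def by (intro A.finsum_closed) (simp add: of_perm_closed)
qed

lemma cycle_in_sym_group:
  assumes "1 \<le> l" "m \<le> n"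
  shows "cycle_of_list [l..<Suc m] \<in> carrier (sym_group n)"
  unfolding sym_group_carrier
  by (rule permutes_subset[OF cycle_permutes]) (use assms in auto)

end

theory Submission
  imports Defs
begin

text \<open>
  Write \<open>s\<^sub>k\<close> for the transposition of \<open>k\<close> and \<open>k + 1\<close>, so that
  \<open>t\<^sub>n = 1\<close> and \<open>t\<^sub>k = 1 + s\<^sub>k t\<^sub>k\<^sub>+\<^sub>1\<close>. Put
  \<open>d\<^sub>k = t\<^sub>k\<^sub>+\<^sub>1 - t\<^sub>k + 1 = (1 - s\<^sub>k) t\<^sub>k\<^sub>+\<^sub>1\<close>. The identity
  \<open>t\<^sub>k\<^sub>+\<^sub>1 t\<^sub>k = (t\<^sub>k - 1) t\<^sub>k\<close> yields \<open>d\<^sub>k t\<^sub>k = 0\<close> and \<open>[t\<^sub>k, t\<^sub>k\<^sub>+\<^sub>1] = t\<^sub>k d\<^sub>k\<close>.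
  As \<open>[t\<^sub>i, t\<^sub>j] = s\<^sub>i [t\<^sub>i\<^sub>+\<^sub>1, t\<^sub>j]\<close> for \<open>i + 2 \<le> j\<close>, it follows that \<open>[t\<^sub>i, t\<^sub>j\<^sub>+\<^sub>1]\<close> is a left
  multiple \<open>v d\<^sub>j\<close> of \<open>d\<^sub>j\<close>, and that \<open>d\<^sub>j [t\<^sub>i, t\<^sub>j\<^sub>+\<^sub>1] = [t\<^sub>i, t\<^sub>j] d\<^sub>j\<close> for \<open>i < j\<close>. Hence
  \<open>[t\<^sub>i, t\<^sub>j\<^sub>+\<^sub>1]\<^sup>p\<^sup>+\<^sup>1 = v [t\<^sub>i, t\<^sub>j]\<^sup>p d\<^sub>j\<close>, and the nilpotency follows by induction on \<open>j\<close>.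
\<close>

section \<open>Shuffles in a ring with Coxeter generators\<close>

text \<open>The argument runs in any ring with elements \<open>s k\<close> obeying the Coxeter
  relations of the symmetric group; the recursion determines each \<open>t k\<close> downwards from
  \<open>t n\<close>.\<close>

locale shuffle_ring = ring A for A (structure) +
  fixes n :: nat and s t :: "nat \<Rightarrow> 'a"
  assumes s_closed: "\<lbrakk>1 \<le> k; k < n\<rbrakk> \<Longrightarrow> s k \<in> carrier A"
    and s_square: "\<lbrakk>1 \<le> k; k < n\<rbrakk> \<Longrightarrow> s k \<otimes> s k = \<one>"
    and s_braid: "\<lbrakk>1 \<le> k; Suc k < n\<rbrakk>
      \<Longrightarrow> s k \<otimes> (s (Suc k) \<otimes> s k) = s (Suc k) \<otimes> (s k \<otimes> s (Suc k))"
    and s_commute: "\<lbrakk>1 \<le> k; Suc k < l; l < n\<rbrakk> \<Longrightarrow> s k \<otimes> s l = s l \<otimes> s k"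
    and t_last: "t n = \<one>"
    and t_step: "\<lbrakk>1 \<le> k; k < n\<rbrakk> \<Longrightarrow> t k = \<one> \<oplus> s k \<otimes> t (Suc k)"
begin

definition d :: "nat \<Rightarrow> 'a"
  where "d k = t (Suc k) \<ominus> s k \<otimes> t (Suc k)"

lemma t_closed: "1 \<le> k \<Longrightarrow> k \<le> n \<Longrightarrow> t k \<in> carrier A"
proof (induction "n - k" arbitrary: k)
  case 0
  then show ?case using t_last by simp
next
  case (Suc m)
  then show ?case
    using s_closed[of k] by (simp add: t_step)
qed

lemma d_closed: "1 \<le> k \<Longrightarrow> k < n \<Longrightarrow> d k \<in> carrier A"
  by (simp add: d_def s_closed t_closed)

text \<open>Unfolding the recursion makes \<open>t l\<close> a polynomial in \<open>s l\<close>,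
  ..., \<open>s (n - 1)\<close>, all of which commute with \<open>s k\<close>.\<close>

lemma t_commute: "\<lbrakk>1 \<le> k; Suc k < l; l \<le> n\<rbrakk> \<Longrightarrow> t l \<otimes> s k = s k \<otimes> t l"
proof (induction "n - l" arbitrary: l)
  case 0
  then show ?case using t_last s_closed[of k] by simp
next
  case (Suc m)
  have c: "s k \<in> carrier A" "s l \<in> carrier A" "t (Suc l) \<in> carrier A"
    using Suc by (auto intro: s_closed t_closed)
  have *: "t (Suc l) \<otimes> s k = s k \<otimes> t (Suc l)"
    using Suc by simp
  have "s l \<otimes> t (Suc l) \<otimes> s k = s k \<otimes> (s l \<otimes> t (Suc l))"
    using c Suc.hyps Suc.prems by (simp add: m_assoc *) (simp add: s_commute[of k l] flip: m_assoc)
  then show ?case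
    using c Suc by (simp add: t_step l_distr r_distr)
qed

text \<open>Since \<open>s k \<otimes> t (Suc k)\<close> is \<open>t k\<close> minus 1, this is the
  key quadratic identity of the overview. The product expands into \<open>v\<close>,
  \<open>s k \<otimes> v\<close> and \<open>r \<otimes> (s k \<otimes> w)\<close>; left
  multiplication by \<open>s k\<close> swaps the first two and fixes the third.\<close>

lemma s_t_absorb:
  "\<lbrakk>1 \<le> k; k < n\<rbrakk> \<Longrightarrow> s k \<otimes> (t (Suc k) \<otimes> t k) = t (Suc k) \<otimes> t k"
proof (induction "n - k" arbitrary: k)
  \<comment> \<open>Vacuous, as \<open>k < n\<close>; the actual base is \<open>Suc k = n\<close>
    below.\<close>
  case 0
  then show ?case by simp
next
  case (Suc m)
  show ?case
  proof (cases "Suc k = n")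
    case True
    then show ?thesis
      using Suc.prems t_last s_closed[of k] s_square[of k]
      by (simp add: t_step r_distr a_comm)
  next
    case False
    define r u v w where "r = s (Suc k)" and "u = t (Suc (Suc k))" and "v = t (Suc k)"
      and "w = u \<otimes> v"
    have c: "s k \<in> carrier A" "r \<in> carrier A" "u \<in> carrier A" "v \<in> carrier A" "w \<in> carrier A"
      using Suc.prems False by (auto simp: r_def u_def v_def w_def intro!: s_closed t_closed)
    have rw: "r \<otimes> w = w"
      unfolding w_def r_def u_def v_def using Suc.prems Suc.hyps False by simp
    have v: "v = \<one> \<oplus> r \<otimes> u"
      unfolding v_def r_def u_def using Suc.prems False by (intro t_step) auto
    have tk: "t k = \<one> \<oplus> s k \<otimes> v"
      unfolding v_def using Suc.prems by (simp add: t_step)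
    have us: "u \<otimes> s k = s k \<otimes> u"
      unfolding u_def using Suc.prems False by (simp add: t_commute)
    have "r \<otimes> u \<otimes> (s k \<otimes> v) = r \<otimes> ((u \<otimes> s k) \<otimes> v)"
      using c by (simp add: m_assoc)
    also have "\<dots> = r \<otimes> (s k \<otimes> w)"
      using c by (simp add: us w_def m_assoc)
    finally have "v \<otimes> (s k \<otimes> v) = s k \<otimes> v \<oplus> r \<otimes> (s k \<otimes> w)"
      using c by (subst v) (simp add: l_distr)
    then have vt: "v \<otimes> t k = v \<oplus> (s k \<otimes> v \<oplus> r \<otimes> (s k \<otimes> w))"
      using c by (simp add: tk r_distr)
    \<comment> \<open>The braid relation moves \<open>r\<close> next to \<open>w\<close>, where the
      induction hypothesis \<open>rw\<close> absorbs it.\<close>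
    have "s k \<otimes> (r \<otimes> (s k \<otimes> w)) = s k \<otimes> (r \<otimes> s k) \<otimes> w"
      using c by (simp add: m_assoc)
    also have "\<dots> = r \<otimes> (s k \<otimes> (r \<otimes> w))"
      using c Suc.prems False s_braid[of k] by (simp add: r_def m_assoc)
    finally have srs: "s k \<otimes> (r \<otimes> (s k \<otimes> w)) = r \<otimes> (s k \<otimes> w)"
      by (simp add: rw)
    have ss: "s k \<otimes> (s k \<otimes> v) = v"
      using c Suc.prems by (simp add: s_square flip: m_assoc)
    show ?thesis
      using c by (simp add: vt r_distr srs ss a_ac flip: v_def)
  qed
qed

text \<open>\<open>d k\<close> is (1 - \<open>s k\<close>) times \<open>t (Suc k)\<close>, and the
  first factor kills what \<open>s k\<close> fixes.\<close>

lemma d_mult_t: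
  assumes "1 \<le> k" "k < n"
  shows "d k \<otimes> t k = \<zero>"
  using assms s_t_absorb[of k] s_closed[of k] t_closed[of k] t_closed[of "Suc k"]
  by (simp add: d_def minus_eq l_distr l_minus m_assoc r_neg)

section \<open>Factorizations of the commutators\<close>

lemma commutator_closed:
  "\<lbrakk>a \<in> carrier A; b \<in> carrier A\<rbrakk> \<Longrightarrow> ring_commutator A a b \<in> carrier A"
  by (simp add: ring_commutator_def)

lemma commutator_adjacent:
  assumes "1 \<le> k" "k < n"
  shows "ring_commutator A (t k) (t (Suc k)) = t k \<otimes> d k"
proof -
  define v where "v = t (Suc k)"
  have c: "s k \<in> carrier A" "v \<in> carrier A"
    using assms by (auto simp: v_def intro: s_closed t_closed)
  have tk: "t k = \<one> \<oplus> s k \<otimes> v"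
    using assms by (simp add: t_step v_def)
  \<comment> \<open>By absorption the left side is \<open>s k \<otimes> v \<otimes> t k\<close>, and
    \<open>s k \<otimes> v\<close>, being \<open>t k\<close> minus 1, commutes with
    \<open>t k\<close>.\<close>
  have "v \<otimes> t k = t k \<otimes> (s k \<otimes> v)"
    using s_t_absorb[OF assms] c unfolding v_def[symmetric] tk
    by (simp add: l_distr r_distr m_assoc)
  then show ?thesis
    using c unfolding ring_commutator_def d_def v_def[symmetric] tk
    by (simp add: minus_eq r_distr r_minus)
qed

text \<open>A second factorization, now with a \<open>d\<close> on the left; it starts the induction
  in \<open>d_mult_commutator\<close>.\<close>

lemma commutator_adjacent':
  assumes "1 \<le> k" "Suc k < n"
  shows "ring_commutator A (t k) (t (Suc k)) = d (Suc k) \<otimes> (s k \<otimes> t (Suc k))"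
proof -
  define r u v where "r = s (Suc k)" and "u = t (Suc (Suc k))" and "v = t (Suc k)"
  have c: "s k \<in> carrier A" "r \<in> carrier A" "u \<in> carrier A" "v \<in> carrier A"
    using assms by (auto simp: r_def u_def v_def intro!: s_closed t_closed)
  have v: "v = \<one> \<oplus> r \<otimes> u"
    unfolding v_def r_def u_def using assms by (intro t_step) auto
  have tk: "t k = \<one> \<oplus> s k \<otimes> v"
    unfolding v_def using assms by (simp add: t_step)
  have us: "u \<otimes> s k = s k \<otimes> u"
    unfolding u_def using assms by (simp add: t_commute)
  have usv: "u \<otimes> (s k \<otimes> v) = s k \<otimes> (u \<otimes> v)"
    using c us by (simp flip: m_assoc)
  have ruv: "r \<otimes> (u \<otimes> v) = u \<otimes> v"
    using s_t_absorb[of "Suc k"] assms unfolding r_def u_def v_def by simp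
  have "s k \<otimes> v \<otimes> v = s k \<otimes> v \<oplus> s k \<otimes> (u \<otimes> v)"
  proof -
    have "v \<otimes> v = v \<oplus> u \<otimes> v"
      using c ruv by (subst v) (simp add: l_distr m_assoc)
    then show ?thesis
      using c by (simp add: m_assoc r_distr)
  qed
  moreover have "v \<otimes> (s k \<otimes> v) = s k \<otimes> v \<oplus> r \<otimes> (s k \<otimes> (u \<otimes> v))"
    using c usv by (subst v) (simp add: l_distr m_assoc)
  ultimately have "ring_commutator A (t k) v =
      (v \<oplus> (s k \<otimes> v \<oplus> s k \<otimes> (u \<otimes> v))) \<ominus> (v \<oplus> (s k \<otimes> v \<oplus> r \<otimes> (s k \<otimes> (u \<otimes> v))))"
    using c by (simp add: ring_commutator_def tk l_distr r_distr)
  \<comment> \<open>What survives is (1 - \<open>r\<close>) times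
    \<open>s k \<otimes> (u \<otimes> v)\<close>; moving \<open>u\<close> left past
    \<open>s k\<close> produces \<open>d (Suc k)\<close>.\<close>
  also have "\<dots> = s k \<otimes> (u \<otimes> v) \<ominus> r \<otimes> (s k \<otimes> (u \<otimes> v))"
    using c by (simp add: minus_eq minus_add a_ac r_neg r_neg1 r_neg2)
  also have "\<dots> = d (Suc k) \<otimes> (s k \<otimes> v)"
    using c usv unfolding d_def r_def[symmetric] u_def[symmetric]
    by (simp add: minus_eq l_distr l_minus m_assoc)
  finally show ?thesis
    by (simp add: v_def)
qed

text \<open>In \<open>t i\<close>, the summand 1 is central and \<open>s i\<close> commutes with
  \<open>t j\<close>, so \<open>s i\<close> can be pulled out.\<close>

lemma commutator_step:
  assumes "1 \<le> i" "Suc i < j" "j \<le> n"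
  shows "ring_commutator A (t i) (t j) = s i \<otimes> ring_commutator A (t (Suc i)) (t j)"
proof -
  have c: "s i \<in> carrier A" "t (Suc i) \<in> carrier A" "t j \<in> carrier A"
    using assms by (auto intro!: s_closed t_closed)
  have "t j \<otimes> (s i \<otimes> t (Suc i)) = s i \<otimes> (t j \<otimes> t (Suc i))"
    using c assms by (simp add: t_commute flip: m_assoc)
  moreover have "t i = \<one> \<oplus> s i \<otimes> t (Suc i)"
    using assms by (simp add: t_step)
  ultimately show ?thesis
    using c by (simp add: ring_commutator_def minus_eq minus_add l_distr r_distr r_minus
        m_assoc a_ac r_neg r_neg1 r_neg2)
qed

lemma d_commute:
  assumes "1 \<le> i" "Suc i < j" "j < n"
  shows "d j \<otimes> s i = s i \<otimes> d j"
proof -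
  have c: "s i \<in> carrier A" "s j \<in> carrier A" "t (Suc j) \<in> carrier A"
    using assms by (auto intro!: s_closed t_closed)
  have 1: "t (Suc j) \<otimes> s i = s i \<otimes> t (Suc j)"
    using assms by (simp add: t_commute)
  have "s j \<otimes> t (Suc j) \<otimes> s i = s i \<otimes> (s j \<otimes> t (Suc j))"
    using c assms by (simp add: m_assoc 1) (simp add: s_commute[of i j] flip: m_assoc)
  then show ?thesis
    using c 1 by (simp add: d_def minus_eq l_distr r_distr l_minus r_minus)
qed

text \<open>Downward induction on \<open>i\<close>: the witness is \<open>t j\<close> for
  \<open>i = j\<close>, and each step prepends \<open>s i\<close>.\<close>

lemma commutator_left_multiple:
  assumes "1 \<le> i" "i \<le> j" "j < n"
  shows "\<exists>v\<in>carrier A. ring_commutator A (t i) (t (Suc j)) = v \<otimes> d j"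
  using assms(2,1)
proof (induction i rule: inc_induct)
  case base
  then show ?case
    using assms by (auto simp: commutator_adjacent intro!: bexI[of _ "t j"] t_closed)
next
  case (step i)
  then obtain v where v: "v \<in> carrier A"
    "ring_commutator A (t (Suc i)) (t (Suc j)) = v \<otimes> d j"
    by auto
  have c: "s i \<in> carrier A" "d j \<in> carrier A"
    using step assms by (auto intro!: s_closed d_closed)
  have "ring_commutator A (t i) (t (Suc j)) = s i \<otimes> v \<otimes> d j"
    using step assms v c by (simp add: commutator_step m_assoc)
  then show ?case
    using c v by blast
qed

text \<open>Downward induction on \<open>i\<close>. At \<open>i = j - 1\<close> the two adjacent
  factorizations meet: both sides equal
  \<open>d j \<otimes> (s i \<otimes> t j) \<otimes> d j\<close>. For smaller \<open>i\<close>,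
  \<open>s i\<close> commutes with \<open>d j\<close> and comes out of both commutators.\<close>

lemma d_mult_commutator:
  assumes "1 \<le> i" "i < j" "j < n"
  shows "d j \<otimes> ring_commutator A (t i) (t (Suc j)) = ring_commutator A (t i) (t j) \<otimes> d j"
proof -
  obtain k where k: "j = Suc k" "i \<le> k"
    using assms by (metis less_imp_Suc_add le_add1)
  show ?thesis
    using k(2) assms(1)
  proof (induction i rule: inc_induct)
    case base
    have c: "s k \<in> carrier A" "t j \<in> carrier A" "d j \<in> carrier A"
      using base k assms by (auto intro!: s_closed t_closed d_closed)
    have "d j \<otimes> ring_commutator A (t k) (t (Suc j)) = d j \<otimes> (s k \<otimes> t j) \<otimes> d j"
      using c base k assms by (simp add: commutator_step commutator_adjacent m_assoc)
    then show ?case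
      using base k assms commutator_adjacent'[of k] by simp
  next
    case (step i)
    have c: "s i \<in> carrier A" "d j \<in> carrier A"
      "ring_commutator A (t (Suc i)) (t (Suc j)) \<in> carrier A"
      "ring_commutator A (t (Suc i)) (t j) \<in> carrier A"
      using step k assms by (auto intro!: s_closed t_closed d_closed commutator_closed)
    have "d j \<otimes> ring_commutator A (t i) (t (Suc j)) =
        d j \<otimes> s i \<otimes> ring_commutator A (t (Suc i)) (t (Suc j))"
      using step k assms c by (simp add: commutator_step m_assoc)
    also have "\<dots> = s i \<otimes> (d j \<otimes> ring_commutator A (t (Suc i)) (t (Suc j)))"
      using step k assms c by (simp add: d_commute m_assoc)
    also have "\<dots> = ring_commutator A (t i) (t j) \<otimes> d j"
      using step k assms c by (simp add: commutator_step m_assoc)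
    finally show ?case .
  qed
qed

section \<open>Nilpotency\<close>

lemma mult_pow_intertwine:
  assumes "a \<in> carrier A" "x \<in> carrier A" "y \<in> carrier A" "a \<otimes> x = y \<otimes> a"
  shows "a \<otimes> x [^] (p::nat) = y [^] p \<otimes> a"
proof (induction p)
  case (Suc p)
  have "a \<otimes> x [^] Suc p = y [^] p \<otimes> (a \<otimes> x)"
    using assms(1-3) Suc by (simp flip: m_assoc)
  then show ?case
    using assms by (simp flip: m_assoc)
qed (use assms in simp)

theorem commutator_nilpotent:
  assumes "1 \<le> i" "i \<le> j" "j \<le> n"
  shows "ring_commutator A (t i) (t j) [^] (j - i + 1) = \<zero>"
  using assms(2,3)
proof (induction j rule: dec_induct)
  case base
  then show ?case
    using assms t_closed[of i] by (simp add: ring_commutator_def minus_eq r_neg)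
next
  case (step j)
  define x y where "x = ring_commutator A (t i) (t (Suc j))" and "y = ring_commutator A (t i) (t j)"
  have c: "x \<in> carrier A" "y \<in> carrier A" "d j \<in> carrier A" "t i \<in> carrier A"
    using step assms unfolding x_def y_def by (auto intro!: t_closed d_closed commutator_closed)
  obtain v where v: "v \<in> carrier A" "x = v \<otimes> d j"
    using commutator_left_multiple[of i j] step assms unfolding x_def by auto
  have "d j \<otimes> x = y \<otimes> d j"
  \<comment> \<open>For \<open>i = j\<close> both sides vanish: \<open>d j\<close> kills
    \<open>t j\<close>, and \<open>y\<close> is the commutator of \<open>t j\<close> with
    itself.\<close>
  proof (cases "i = j")
    case True
    have "d j \<otimes> x = d j \<otimes> t j \<otimes> d j"
      using True step assms c by (simp add: x_def commutator_adjacent m_assoc)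
    moreover have "y = \<zero>"
      using True c by (simp add: y_def ring_commutator_def minus_eq r_neg)
    ultimately show ?thesis
      using True step assms c by (simp add: d_mult_t)
  next
    case False
    then show ?thesis
      using step assms unfolding x_def y_def by (intro d_mult_commutator) auto
  qed
  then have *: "d j \<otimes> x [^] (j - i + 1) = y [^] (j - i + 1) \<otimes> d j"
    using c by (intro mult_pow_intertwine)
  \<comment> \<open>The leftmost factor is split off, so that its \<open>d j\<close> can travel
    right through the remaining power and turn each \<open>x\<close> into \<open>y\<close>.\<close>
  have "x [^] Suc (j - i + 1) = v \<otimes> d j \<otimes> x [^] (j - i + 1)"
    using c nat_pow_Suc2[of x] v(2) by metis
  also have "\<dots> = v \<otimes> (y [^] (j - i + 1) \<otimes> d j)"
    using c v(1) * by (simp add: m_assoc del: nat_pow_Suc)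
  also have "\<dots> = \<zero>"
    using step c v(1) by (simp add: y_def del: nat_pow_Suc)
  finally show ?case
    using step by (simp add: x_def Suc_diff_le del: nat_pow_Suc)
qed

end

section \<open>The group algebra as an instance\<close>

lemma transpose_in_sym_group:
  "\<lbrakk>1 \<le> k; k < n\<rbrakk> \<Longrightarrow> transpose k (Suc k) \<in> carrier (sym_group n)"
  unfolding sym_group_carrier by (intro permutes_swap_id) auto

lemma (in cring) of_perm_id: "of_perm R n id = \<one>\<^bsub>sym_group_algebra R n\<^esub>"
  by (simp add: of_perm_def sym_group_algebra_def sym_group_one)

lemma (in cring) somewhere_to_below_last:
  "somewhere_to_below R n n = \<one>\<^bsub>sym_group_algebra R n\<^esub>"
proof -
  interpret A: ring "sym_group_algebra R n"
    by (rule ring_sym_group_algebra)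
  show ?thesis
    by (simp add: somewhere_to_below_def of_perm_id)
qed

text \<open>For \<open>m > k\<close> the cycle through \<open>k\<close>, ..., \<open>m\<close> is
  the transposition of \<open>k\<close> and \<open>k + 1\<close> composed with the cycle through
  \<open>k + 1\<close>, ..., \<open>m\<close>.\<close>

lemma (in cring) somewhere_to_below_step:
  assumes "1 \<le> k" "k < n"
  shows "somewhere_to_below R n k = \<one>\<^bsub>sym_group_algebra R n\<^esub> \<oplus>\<^bsub>sym_group_algebra R n\<^esub>
    of_perm R n (transpose k (Suc k)) \<otimes>\<^bsub>sym_group_algebra R n\<^esub> somewhere_to_below R n (Suc k)"
proof -
  define A where "A = sym_group_algebra R n"
  interpret A: ring A
    unfolding A_def by (rule ring_sym_group_algebra)
  note [simp] = of_perm_closed[where n = n, folded A_def]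
  have "of_perm R n (cycle_of_list [k..<Suc m]) =
      of_perm R n (transpose k (Suc k)) \<otimes>\<^bsub>A\<^esub> of_perm R n (cycle_of_list [Suc k..<Suc m])"
    if "m \<in> {Suc k..n}" for m
  proof -
    \<comment> \<open>Exposing two leading entries lets the recursion of
      \<open>cycle_of_list\<close> split off the transposition.\<close>
    have "[k..<Suc m] = k # Suc k # [Suc (Suc k)..<Suc m]"
      "[Suc k..<Suc m] = Suc k # [Suc (Suc k)..<Suc m]"
      using that by (simp_all add: upt_conv_Cons del: upt_Suc)
    then have "cycle_of_list [k..<Suc m] =
        transpose k (Suc k) \<circ> cycle_of_list [Suc k..<Suc m]"
      by simp
    then show ?thesis
      unfolding A_def using assms that
      by (simp add: of_perm_mult transpose_in_sym_group cycle_in_sym_group del: upt_Suc)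
  qed
  then have "(\<Oplus>\<^bsub>A\<^esub>m\<in>{Suc k..n}. of_perm R n (cycle_of_list [k..<Suc m])) =
      of_perm R n (transpose k (Suc k)) \<otimes>\<^bsub>A\<^esub> somewhere_to_below R n (Suc k)"
    unfolding somewhere_to_below_def A_def[symmetric]
    by (simp add: A.finsum_rdistr cong: A.finsum_cong del: upt_Suc)
  \<comment> \<open>The remaining summand \<open>m = k\<close> is the trivial cycle, which supplies
    the 1.\<close>
  moreover have "{k..n} = insert k {Suc k..n}"
    using assms by auto
  ultimately show ?thesis
    unfolding A_def[symmetric] somewhere_to_below_def[of R n k]
    by (simp add: A.finsum_insert of_perm_id[of n, folded A_def] del: upt_Suc)
      (simp add: of_perm_id[of n, folded A_def])
qed

lemma (in cring) shuffle_ring_sym_group_algebra: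
  "shuffle_ring (sym_group_algebra R n) n
    (\<lambda>k. of_perm R n (transpose k (Suc k))) (somewhere_to_below R n)"
proof -
  interpret A: ring "sym_group_algebra R n"
    by (rule ring_sym_group_algebra)
  note [simp] = of_perm_mult transpose_in_sym_group
  have comp: "p \<circ> q \<in> carrier (sym_group n)"
    if "p \<in> carrier (sym_group n)" "q \<in> carrier (sym_group n)" for p q
    using that unfolding sym_group_carrier by (auto intro: permutes_compose)
  show ?thesis
  proof
    fix k assume "1 \<le> k" "Suc k < n"
    \<comment> \<open>The braid relation is checked pointwise on permutations and then carried over
      by \<open>of_perm_mult\<close>.\<close>
    moreover have "transpose k (Suc k) \<circ> (transpose (Suc k) (Suc (Suc k)) \<circ> transpose k (Suc k)) =
        transpose (Suc k) (Suc (Suc k)) \<circ> (transpose k (Suc k) \<circ> transpose (Suc k) (Suc (Suc k)))"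
      by (auto simp: fun_eq_iff transpose_def)
    ultimately show "of_perm R n (transpose k (Suc k)) \<otimes>\<^bsub>sym_group_algebra R n\<^esub>
        (of_perm R n (transpose (Suc k) (Suc (Suc k))) \<otimes>\<^bsub>sym_group_algebra R n\<^esub>
          of_perm R n (transpose k (Suc k))) =
      of_perm R n (transpose (Suc k) (Suc (Suc k))) \<otimes>\<^bsub>sym_group_algebra R n\<^esub>
        (of_perm R n (transpose k (Suc k)) \<otimes>\<^bsub>sym_group_algebra R n\<^esub>
          of_perm R n (transpose (Suc k) (Suc (Suc k))))"
      by (simp add: comp)
  next
    fix k l assume "1 \<le> k" "Suc k < l" "l < n"
    moreover have "transpose k (Suc k) \<circ> transpose l (Suc l) =
        transpose l (Suc l) \<circ> transpose k (Suc k)"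
      using \<open>Suc k < l\<close> by (auto simp: fun_eq_iff transpose_def)
    ultimately show "of_perm R n (transpose k (Suc k)) \<otimes>\<^bsub>sym_group_algebra R n\<^esub>
        of_perm R n (transpose l (Suc l)) =
      of_perm R n (transpose l (Suc l)) \<otimes>\<^bsub>sym_group_algebra R n\<^esub>
        of_perm R n (transpose k (Suc k))"
      by simp
  qed (simp_all add: of_perm_closed of_perm_id somewhere_to_below_last somewhere_to_below_step)
qed

theorem corollary9p11:
  fixes R :: "('a, 'b) ring_scheme" and n i j :: nat
  assumes "cring R"
    and "i \<in> {1..n}" and "j \<in> {1..n}" and "i \<le> j"
  shows "ring_commutator (sym_group_algebra R n)
           (somewhere_to_below R n i) (somewhere_to_below R n j)
           [^]\<^bsub>sym_group_algebra R n\<^esub> (j - i + 1) = \<zero>\<^bsub>sym_group_algebra R n\<^esub>"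
  using assms shuffle_ring.commutator_nilpotent[OF cring.shuffle_ring_sym_group_algebra]
  by simp

end
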